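(* The relative simplicial complex $X=(Q^*,A^* )$ is not partitionable.
   Context: $Q^*$ is the $3$-dimensional simplicial complex on vertex set $\{0,1,\dots,13\}$ whose faces are all subsets of the following $20$ facets: $\{2,5,6,12\}$, $\{1,5,8,11\}$, $\{0,1,2,5\}$, $\{1,4,8,9\}$, $\{1,2,3,10\}$, $\{4,5,8,13\}$, $\{0,1,2,3\}$, $\{1,4,9,10\}$, $\{1,2,9,10\}$, $\{1,2,5,6\}$, $\{0,2,5,12\}$, $\{4,5,7,13\}$, $\{1,4,5,8\}$, $\{1,2,6,9\}$, $\{1,3,4,7\}$, $\{1,3,4,10\}$, $\{1,5,6,11\}$, $\{1,4,5,7\}$, $\{1,6,9,11\}$, $\{1,8,9,11\}$. $A^*$ is the induced subcomplex of $Q^*$ on vertex set $\{0,2,3,4,6,7,8,10,12,13\}$; its facets are $\{0,2,3\}$, $\{4,7,13\}$, $\{3,4,10\}$, $\{0,2,12\}$, $\{3,4,7\}$, $\{2,3,10\}$, $\{2,6,12\}$, $\{4,8,13\}$. A relative simplicial complex $(\Delta,\Gamma)$ is a pair of simplicial complexes with $\Gamma\subseteq\Delta$; its faces are the elements of $\Delta\setminus\Gamma$, and its facets are the inclusion-maximal faces of $\Delta\setminus\Gamma$. A pure relative complex with facets $F_1,\dots,F_n$ is partitionable if its set of faces is a disjoint union of Boolean intervals $[R_i,F_i]=\{G : R_i\subseteq G\subseteq F_i\}$, $i=1,\dots,n$ (each interval consisting of faces of the relative complex). *)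

theory Defs
  imports Main
begin

text \<open>A simplicial complex on vertices of type nat is represented as its set of faces
 (a downward-closed family of finite vertex sets, including the empty face).\<close>

definition generated_complex :: "nat set set \<Rightarrow> nat set set" where
  "generated_complex Fs = {G. \<exists>F\<in>Fs. G \<subseteq> F}"

definition induced_subcomplex :: "nat set set \<Rightarrow> nat set \<Rightarrow> nat set set" where
  "induced_subcomplex D W = {G \<in> D. G \<subseteq> W}"

definition rel_faces :: "nat set set \<Rightarrow> nat set set \<Rightarrow> nat set set" where
  "rel_faces D G = D - G"

definition rel_facets :: "nat set set \<Rightarrow> nat set set \<Rightarrow> nat set set" where
  "rel_facets D G = {F \<in> rel_faces D G. \<forall>H \<in> rel_faces D G. F \<subseteq> H \<longrightarrow> H = F}"

definition boolean_interval :: "nat set \<Rightarrow> nat set \<Rightarrow> nat set set" where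
  "boolean_interval R F = {G. R \<subseteq> G \<and> G \<subseteq> F}"

definition partitionable :: "nat set set \<Rightarrow> nat set set \<Rightarrow> bool" where
  "partitionable D G \<longleftrightarrow>
     (\<exists>R :: nat set \<Rightarrow> nat set.
        (\<forall>F \<in> rel_facets D G. R F \<subseteq> F \<and> boolean_interval (R F) F \<subseteq> rel_faces D G) \<and>
        (\<forall>F1 \<in> rel_facets D G. \<forall>F2 \<in> rel_facets D G. F1 \<noteq> F2 \<longrightarrow>
            boolean_interval (R F1) F1 \<inter> boolean_interval (R F2) F2 = {}) \<and>
        rel_faces D G = (\<Union>F \<in> rel_facets D G. boolean_interval (R F) F))"

definition Qstar :: "nat set set" where
  "Qstar = generated_complex
    {{2,5,6,12}, {1,5,8,11}, {0,1,2,5}, {1,4,8,9}, {1,2,3,10}, {4,5,8,13}, {0,1,2,3},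
     {1,4,9,10}, {1,2,9,10}, {1,2,5,6}, {0,2,5,12}, {4,5,7,13}, {1,4,5,8}, {1,2,6,9},
     {1,3,4,7}, {1,3,4,10}, {1,5,6,11}, {1,4,5,7}, {1,6,9,11}, {1,8,9,11}}"

definition Astar :: "nat set set" where
  "Astar = induced_subcomplex Qstar {0,2,3,4,6,7,8,10,12,13}"

end

theory Submission
  imports Defs
begin

text \<open>Write 1256 for \<open>{1,2,5,6}\<close>, with a, b for the vertices 10, 11 in fact names. Suppose the intervals \<open>[R F, F]\<close> partition the faces. A triangle lying in a single facet \<open>F\<close>
  contains \<open>R F\<close>, and no \<open>R F\<close> lies in \<open>A\<^sup>*\<close>; this forces the edges 16 and 18 into the intervals of
  1256 and 1458. Now the triangle 123 is covered by one of its two facets. If it is \<open>{1,2,3,10}\<close>,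
  then so is the edge 12, which forces first 125 and then the edge 15 into the interval of 0125, and
  nothing can cover 145. If it is 0123, then so is the edge 13, which forces the edge 14 into the
  interval of \<open>{1,3,4,10}\<close>, then 145 and the edge 15 into that of 1457, and nothing can cover 125.\<close>

definition Qstar_facets :: "nat set set" where
  "Qstar_facets =
    {{2,5,6,12}, {1,5,8,11}, {0,1,2,5}, {1,4,8,9}, {1,2,3,10}, {4,5,8,13}, {0,1,2,3},
     {1,4,9,10}, {1,2,9,10}, {1,2,5,6}, {0,2,5,12}, {4,5,7,13}, {1,4,5,8}, {1,2,6,9},
     {1,3,4,7}, {1,3,4,10}, {1,5,6,11}, {1,4,5,7}, {1,6,9,11}, {1,8,9,11}}"

definition Astar_vertices :: "nat set" where
  "Astar_vertices = {0,2,3,4,6,7,8,10,12,13}"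

text \<open>Since \<open>Astar\<close> is induced, a face of \<open>Qstar\<close> belongs to it
  exactly when its vertices do. Membership thus becomes inclusion tests between explicit sets, which
  \<open>simp\<close> can decide.\<close>

lemma rel_faces_Qstar_Astar:
  "rel_faces Qstar Astar = {G. (\<exists>F\<in>Qstar_facets. G \<subseteq> F) \<and> \<not> G \<subseteq> Astar_vertices}"
proof -
  have Q: "Qstar = {G. \<exists>F\<in>Qstar_facets. G \<subseteq> F}"
    unfolding Qstar_def generated_complex_def Qstar_facets_def ..
  have A: "Astar = {G \<in> Qstar. G \<subseteq> Astar_vertices}"
    unfolding Astar_def induced_subcomplex_def Astar_vertices_def ..
  show ?thesis unfolding rel_faces_def A Q by blast
qed

lemma Qstar_facets_card: "\<forall>F\<in>Qstar_facets. finite F \<and> card F = 4"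
  unfolding Qstar_facets_def by simp

lemma Qstar_facets_not_subset: "\<forall>F\<in>Qstar_facets. \<not> F \<subseteq> Astar_vertices"
  unfolding Qstar_facets_def Astar_vertices_def by simp

lemma Qstar_facets_antichain:
  assumes "F \<in> Qstar_facets" "F' \<in> Qstar_facets" "F \<subseteq> F'"
  shows "F = F'"
  using assms Qstar_facets_card by (intro card_subset_eq) simp_all

text \<open>No facet of \<open>Qstar\<close> lies in \<open>Astar_vertices\<close>, so all of them
  survive as relative faces; having equal size, none contains another.\<close>

lemma rel_facets_Qstar_Astar: "rel_facets Qstar Astar = Qstar_facets"
proof (rule set_eqI, rule iffI)
  fix F assume F: "F \<in> rel_facets Qstar Astar"
  then obtain F' where F': "F' \<in> Qstar_facets" "F \<subseteq> F'"
    unfolding rel_facets_def rel_faces_Qstar_Astar by blast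
  then have "F' \<in> rel_faces Qstar Astar"
    using Qstar_facets_not_subset unfolding rel_faces_Qstar_Astar by blast
  then have "F' = F" using F F'(2) unfolding rel_facets_def by blast
  with F'(1) show "F \<in> Qstar_facets" by simp
next
  fix F assume F: "F \<in> Qstar_facets"
  have "H = F" if H: "H \<in> rel_faces Qstar Astar" "F \<subseteq> H" for H
  proof -
    obtain F' where F': "F' \<in> Qstar_facets" "H \<subseteq> F'"
      using H(1) unfolding rel_faces_Qstar_Astar by blast
    then have "F = F'" using Qstar_facets_antichain[OF F] H(2) by blast
    with F'(2) H(2) show ?thesis by simp
  qed
  moreover have "F \<in> rel_faces Qstar Astar"
    using F Qstar_facets_not_subset unfolding rel_faces_Qstar_Astar by blast
  ultimately show "F \<in> rel_facets Qstar Astar"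
    unfolding rel_facets_def by blast
qed

theorem theorem3p6:
  shows "\<not> partitionable Qstar Astar"
proof
  assume "partitionable Qstar Astar"
  then obtain R where
    valid: "\<forall>F\<in>Qstar_facets. R F \<subseteq> F \<and> boolean_interval (R F) F \<subseteq> rel_faces Qstar Astar" and
    disjoint: "\<forall>F1\<in>Qstar_facets. \<forall>F2\<in>Qstar_facets. F1 \<noteq> F2 \<longrightarrow>
      boolean_interval (R F1) F1 \<inter> boolean_interval (R F2) F2 = {}" and
    cover: "rel_faces Qstar Astar = (\<Union>F\<in>Qstar_facets. boolean_interval (R F) F)"
    unfolding partitionable_def rel_facets_Qstar_Astar by (elim exE conjE) (rule that)
  have cov: "\<exists>F\<in>Qstar_facets. G \<subseteq> F \<and> R F \<subseteq> G"
    if "\<exists>F\<in>Qstar_facets. G \<subseteq> F" "\<not> G \<subseteq> Astar_vertices" for G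
  proof -
    have "G \<in> rel_faces Qstar Astar"
      using that unfolding rel_faces_Qstar_Astar by blast
    then show ?thesis unfolding cover boolean_interval_def by blast
  qed
  \<comment> \<open>The premise \<open>R F1 \<subseteq> G\<close> comes first so that
    \<open>OF\<close> with a known covering of \<open>G\<close> fixes both \<open>F1\<close> and
    \<open>G\<close>.\<close>
  have uniq: "\<not> R F2 \<subseteq> G"
    if "R F1 \<subseteq> G" "G \<subseteq> F1" "G \<subseteq> F2" "F1 \<in> Qstar_facets" "F2 \<in> Qstar_facets" "F1 \<noteq> F2"
    for F1 F2 G
    using disjoint that unfolding boolean_interval_def by blast
  have "\<not> R F \<subseteq> Astar_vertices" if "F \<in> Qstar_facets" for F
  proof -
    have "R F \<in> rel_faces Qstar Astar"
      using valid that unfolding boolean_interval_def by blast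
    then show ?thesis unfolding rel_faces_Qstar_Astar by blast
  qed
  \<comment> \<open>Two upper bounds on \<open>R F\<close> meeting inside
    \<open>Astar_vertices\<close> are incompatible. This rules out candidate facets for covering a
    face \<open>S\<close> when \<open>T\<close> is an already known bound.\<close>
  then have not_both: "\<not> (R F \<subseteq> S \<and> R F \<subseteq> T)"
    if "S \<inter> T \<subseteq> Astar_vertices" "F \<in> Qstar_facets" for F S T
    using that by blast
  note defs = Qstar_facets_def Astar_vertices_def

  have R0123: "R {0,1,2,3} \<subseteq> {0,1,3}" using cov[of "{0,1,3}"] by (simp add: defs)
  have R0125: "R {0,1,2,5} \<subseteq> {0,1,5}" using cov[of "{0,1,5}"] by (simp add: defs)
  have R1347: "R {1,3,4,7} \<subseteq> {1,3,7}" using cov[of "{1,3,7}"] by (simp add: defs)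
  have R1457: "R {1,4,5,7} \<subseteq> {1,5,7}" using cov[of "{1,5,7}"] by (simp add: defs)
  \<comment> \<open>From here on the triangles omit the vertex 1, so that they meet the edges and
    triangles through 1 considered below inside \<open>Astar_vertices\<close>.\<close>
  have R1269: "R {1,2,6,9} \<subseteq> {2,6,9}" using cov[of "{2,6,9}"] by (simp add: defs)
  have R129a: "R {1,2,9,10} \<subseteq> {2,9,10}" using cov[of "{2,9,10}"] by (simp add: defs)
  have R1489: "R {1,4,8,9} \<subseteq> {4,8,9}" using cov[of "{4,8,9}"] by (simp add: defs)
  have R149a: "R {1,4,9,10} \<subseteq> {4,9,10}" using cov[of "{4,9,10}"] by (simp add: defs)
  have R156b: "R {1,5,6,11} \<subseteq> {5,6,11}" using cov[of "{5,6,11}"] by (simp add: defs)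
  have R158b: "R {1,5,8,11} \<subseteq> {5,8,11}" using cov[of "{5,8,11}"] by (simp add: defs)
  have R169b: "R {1,6,9,11} \<subseteq> {6,9,11}" using cov[of "{6,9,11}"] by (simp add: defs)
  have R189b: "R {1,8,9,11} \<subseteq> {8,9,11}" using cov[of "{8,9,11}"] by (simp add: defs)

  \<comment> \<open>Four facets contain the edge 16. For the other three, \<open>R F\<close> would
    lie in \<open>{6}\<close>, a face of \<open>Astar\<close>. The edge 18 is treated alike, with
    \<open>{8}\<close>.\<close>
  have R1256: "R {1,2,5,6} \<subseteq> {1,6}"
    using cov[of "{1,6}"] R1269 R156b R169b
      not_both[of "{1,6}" "{2,6,9}" "{1,2,6,9}"] not_both[of "{1,6}" "{5,6,11}" "{1,5,6,11}"]
      not_both[of "{1,6}" "{6,9,11}" "{1,6,9,11}"]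
    by (simp add: defs)
  have R1458: "R {1,4,5,8} \<subseteq> {1,8}"
    using cov[of "{1,8}"] R1489 R158b R189b
      not_both[of "{1,8}" "{4,8,9}" "{1,4,8,9}"] not_both[of "{1,8}" "{5,8,11}" "{1,5,8,11}"]
      not_both[of "{1,8}" "{8,9,11}" "{1,8,9,11}"]
    by (simp add: defs)
  have R134a: "R {1,3,4,10} \<subseteq> {1,4,10}"
    using cov[of "{1,4,10}"] R149a not_both[of "{1,4,10}" "{4,9,10}" "{1,4,9,10}"]
    by (simp add: defs)

  \<comment> \<open>Only two facets contain 125; intersecting with the bounds \<open>R0125\<close>
    and \<open>R1256\<close> sharpens each alternative.\<close>
  have c125: "R {0,1,2,5} \<subseteq> {1,5} \<or> R {1,2,5,6} \<subseteq> {1}"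
  proof -
    have "R {0,1,2,5} \<subseteq> {1,2,5} \<or> R {1,2,5,6} \<subseteq> {1,2,5}"
      using cov[of "{1,2,5}"] by (simp add: defs)
    then show ?thesis
    proof
      assume "R {0,1,2,5} \<subseteq> {1,2,5}"
      with R0125 have "R {0,1,2,5} \<subseteq> {0,1,5} \<inter> {1,2,5}" by (rule Int_greatest)
      then show ?thesis by simp
    next
      assume "R {1,2,5,6} \<subseteq> {1,2,5}"
      with R1256 have "R {1,2,5,6} \<subseteq> {1,6} \<inter> {1,2,5}" by (rule Int_greatest)
      then show ?thesis by simp
    qed
  qed
  have c145: "R {1,4,5,7} \<subseteq> {1,5} \<or> R {1,4,5,8} \<subseteq> {1}"
  proof -
    have "R {1,4,5,7} \<subseteq> {1,4,5} \<or> R {1,4,5,8} \<subseteq> {1,4,5}"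
      using cov[of "{1,4,5}"] by (auto simp add: defs)
    then show ?thesis
    proof
      assume "R {1,4,5,7} \<subseteq> {1,4,5}"
      with R1457 have "R {1,4,5,7} \<subseteq> {1,5,7} \<inter> {1,4,5}" by (rule Int_greatest)
      then show ?thesis by simp
    next
      assume "R {1,4,5,8} \<subseteq> {1,4,5}"
      with R1458 have "R {1,4,5,8} \<subseteq> {1,8} \<inter> {1,4,5}" by (rule Int_greatest)
      then show ?thesis by simp
    qed
  qed

  have neq: "{0,1,2,5} \<noteq> {1,4,5,7::nat}" "{0,1,2,5} \<noteq> {1,4,5,8::nat}"
    "{1,4,5,7} \<noteq> {1,2,5,6::nat}" "{1,2,3,10} \<noteq> {1,2,5,6::nat}"
    "{0,1,2,3} \<noteq> {1,3,4,7::nat}" "{1,3,4,10} \<noteq> {1,4,5,8::nat}"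
    "{1,4,5,7} \<noteq> {0,1,2,5::nat}"
    by (simp_all add: set_eq_subset)

  have "R {0,1,2,3} \<subseteq> {1,2,3} \<or> R {1,2,3,10} \<subseteq> {1,2,3}"
    using cov[of "{1,2,3}"] by (auto simp add: defs)
  then show False
  proof
    assume "R {1,2,3,10} \<subseteq> {1,2,3}"
    moreover have "R {1,2,3,10} \<subseteq> {1,2,10}"
      using cov[of "{1,2,10}"] R129a not_both[of "{1,2,10}" "{2,9,10}" "{1,2,9,10}"]
      by (auto simp add: defs)
    ultimately have "R {1,2,3,10} \<subseteq> {1,2,3} \<inter> {1,2,10}" by (rule Int_greatest)
    then have a12: "R {1,2,3,10} \<subseteq> {1,2}" by simp
    have "\<not> R {1,2,5,6} \<subseteq> {1,2}"
      using uniq[OF a12, of "{1,2,5,6}"] neq(4) by (simp add: defs)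
    then have "\<not> R {1,2,5,6} \<subseteq> {1}" by blast
    with c125 have a15: "R {0,1,2,5} \<subseteq> {1,5}" by blast
    \<comment> \<open>Either alternative of \<open>c145\<close> would put the edge 15 into a second
      interval, since \<open>{1} \<subseteq> {1,5}\<close>.\<close>
    have "\<not> R {1,4,5,7} \<subseteq> {1,5}" "\<not> R {1,4,5,8} \<subseteq> {1,5}"
      using uniq[OF a15, of "{1,4,5,7}"] uniq[OF a15, of "{1,4,5,8}"] neq(1,2)
      by (simp_all add: defs)
    with c145 show False by blast
  next
    assume "R {0,1,2,3} \<subseteq> {1,2,3}"
    with R0123 have "R {0,1,2,3} \<subseteq> {0,1,3} \<inter> {1,2,3}" by (rule Int_greatest)
    then have a13: "R {0,1,2,3} \<subseteq> {1,3}" by simp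
    have "\<not> R {1,3,4,7} \<subseteq> {1,3}"
      using uniq[OF a13, of "{1,3,4,7}"] neq(5) by (simp add: defs)
    moreover have "{1,3,7} \<inter> {1,3,4} = {1,3::nat}" by simp
    \<comment> \<open>By \<open>R1347\<close>, if 1347 covered 134 it would also cover the edge 13,
      which 0123 already does. Only \<open>{1,3,4,10}\<close> is then left for 134.\<close>
    ultimately have "\<not> R {1,3,4,7} \<subseteq> {1,3,4}" using R1347 by (metis Int_greatest)
    then have "R {1,3,4,10} \<subseteq> {1,3,4}"
      using cov[of "{1,3,4}"] by (auto simp add: defs)
    with R134a have "R {1,3,4,10} \<subseteq> {1,4,10} \<inter> {1,3,4}" by (rule Int_greatest)
    then have a14: "R {1,3,4,10} \<subseteq> {1,4}" by simp
    have "\<not> R {1,4,5,8} \<subseteq> {1,4}"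
      using uniq[OF a14, of "{1,4,5,8}"] neq(6) by (simp add: defs)
    then have "\<not> R {1,4,5,8} \<subseteq> {1}" by blast
    with c145 have a15: "R {1,4,5,7} \<subseteq> {1,5}" by blast
    have "\<not> R {0,1,2,5} \<subseteq> {1,5}" "\<not> R {1,2,5,6} \<subseteq> {1,5}"
      using uniq[OF a15, of "{0,1,2,5}"] uniq[OF a15, of "{1,2,5,6}"] neq(3,7)
      by (simp_all add: defs)
    with c125 show False by blast
  qed
qed

end
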